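(* For every $n\in\mathbf{N}$, $$M_n(\mathbf{R})\cap\Theta_n\subseteq\mathcal{F}_n.$$
   Context: A correlation matrix is a complex, positive semidefinite matrix having all diagonal entries equal to $1$; $\Theta_n$ denotes the set of all $n\times n$ correlation matrices, and $M_n(\mathbf{R})$ the set of $n\times n$ matrices with real entries. $\mathcal{F}_n$ is the closure (in $M_n(\mathbf{C})$) of the set $\{(\mathrm{tr}_k(V_i^*V_j))_{1\le i,j\le n}\mid k\in\mathbf{N},\ V_1,\ldots,V_n\in\mathcal{U}_k\}$, where $\mathcal{U}_k$ is the group of $k\times k$ unitary matrices and $\mathrm{tr}_k$ is the normalized trace on $M_k(\mathbf{C})$ (so $\mathrm{tr}_k(I)=1$). *)

theory Defs
  imports
    "HOL-Analysis.Analysis"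
    "HOL-Library.Complex_Order"
    "Jordan_Normal_Form.Schur_Decomposition"
begin

(* Jordan_Normal_Form also uses the dollar sign, for the entries of its own vectors. *)
no_notation vec_index (infixl "$" 100)

text \<open>
  The size \<open>n\<close> is fixed throughout, so \<open>n \<times> n\<close> matrices are elements of
  \<open>complex ^ 'n ^ 'n\<close>, with the library topology.  The size \<open>k\<close> of the unitaries is
  quantified inside the definition of the set below, so these are matrices of
  Jordan_Normal_Form, whose size is a number and not a type.
\<close>

definition hermitian_matrix :: "complex ^ 'n ^ 'n \<Rightarrow> bool" where
  "hermitian_matrix A \<longleftrightarrow> (\<forall>i j. A $ i $ j = cnj (A $ j $ i))"

text \<open>
  The inequality is the order on the complex numbers of Complex_Order: \<open>0 \<le> z\<close> says that
  \<open>z\<close> is real and nonnegative.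
\<close>

definition psd_matrix :: "complex ^ 'n ^ 'n \<Rightarrow> bool" where
  "psd_matrix A \<longleftrightarrow> hermitian_matrix A \<and>
     (\<forall>x. 0 \<le> (\<Sum>i\<in>UNIV. cnj (x $ i) * (A *v x) $ i))"

definition correlation_matrices :: "(complex ^ 'n ^ 'n) set" where
  "correlation_matrices = {A. psd_matrix A \<and> (\<forall>i. A $ i $ i = 1)}"

definition real_matrices :: "(complex ^ 'n ^ 'n) set" where
  "real_matrices = {A. \<forall>i j. A $ i $ j \<in> \<real>}"

definition unitary_group :: "nat \<Rightarrow> complex Matrix.mat set" where
  "unitary_group k =
     {V \<in> carrier_mat k k. mat_adjoint V * V = 1\<^sub>m k \<and> V * mat_adjoint V = 1\<^sub>m k}"

definition normalized_trace :: "nat \<Rightarrow> complex Matrix.mat \<Rightarrow> complex" where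
  "normalized_trace k A = (\<Sum>l<k. A $$ (l, l)) / of_nat k"

definition unitary_correlation_matrices :: "(complex ^ 'n ^ 'n) set" where
  "unitary_correlation_matrices =
     closure {(\<chi> i j. normalized_trace k (mat_adjoint (V i) * V j)) | k V.
       0 < k \<and> (\<forall>i. V i \<in> unitary_group k)}"

end

theory Submission
  imports Defs
begin

text \<open>
  A real correlation matrix is the Gram matrix of real unit vectors \<open>x\<^sub>i\<close>.  Send a real vector
  \<open>x\<close> to the Clifford matrix \<open>V(x)\<close>, a real linear combination of anticommuting self-adjoint
  unitaries.  Then \<open>V(x)\<^sup>2 = \<bar>x\<bar>\<^sup>2 I\<close> and the normalized trace of \<open>V(x) V(y)\<close> is the inner product
  of \<open>x\<close> and \<open>y\<close>, so the \<open>V(x\<^sub>i)\<close> are unitaries that realise the matrix exactly; the closure is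
  not needed.
\<close>

text \<open>Isolates the variable \<open>y p\<close>: symmetry merges its row and column, so the
  form becomes a quadratic polynomial in \<open>y p\<close>.\<close>

lemma quadratic_form_insert:
  fixes a :: "'a \<Rightarrow> 'a \<Rightarrow> real"
  assumes "finite S" "p \<notin> S" and sym: "\<And>i. i \<in> S \<Longrightarrow> a p i = a i p"
  shows "(\<Sum>i\<in>insert p S. \<Sum>j\<in>insert p S. a i j * y i * y j) =
    (\<Sum>i\<in>S. \<Sum>j\<in>S. a i j * y i * y j) + 2 * y p * (\<Sum>i\<in>S. a i p * y i) + a p p * (y p)\<^sup>2"
proof -
  have "(\<Sum>j\<in>S. a p j * y p * y j) = y p * (\<Sum>i\<in>S. a i p * y i)"
    unfolding sum_distrib_left by (rule sum.cong) (auto simp: sym)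
  moreover have "(\<Sum>i\<in>S. a i p * y i * y p) = y p * (\<Sum>i\<in>S. a i p * y i)"
    unfolding sum_distrib_left by (rule sum.cong) auto
  ultimately show ?thesis
    using assms(1,2) by (simp add: sum.distrib power2_eq_square algebra_simps)
qed

text \<open>Cholesky factorization: one vector coordinate is split off with each Schur complement.\<close>

lemma psd_form_gram:
  fixes a :: "'a \<Rightarrow> 'a \<Rightarrow> real"
  assumes "finite S"
    and "\<And>i j. i \<in> S \<Longrightarrow> j \<in> S \<Longrightarrow> a i j = a j i"
    and "\<And>y. 0 \<le> (\<Sum>i\<in>S. \<Sum>j\<in>S. a i j * y i * y j)"
  shows "\<exists>(m::nat) x. \<forall>i\<in>S. \<forall>j\<in>S. a i j = (\<Sum>s<m. x i s * x j s)"
  using assms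
proof (induction S arbitrary: a rule: finite_induct)
  case empty
  then show ?case by simp
next
  case (insert p S)
  note sym = insert.prems(1) and psd = insert.prems(2)
  \<comment> \<open>The value at \<open>p\<close> becomes a free parameter \<open>t\<close>, so that
    the later steps can pick the most useful \<open>t\<close> for a given \<open>y\<close> on
    \<open>S\<close>.\<close>
  have form: "0 \<le> (\<Sum>i\<in>S. \<Sum>j\<in>S. a i j * y i * y j) + 2 * t * (\<Sum>i\<in>S. a i p * y i) + a p p * t\<^sup>2"
    for y t
  proof -
    let ?y = "y(p := t)"
    have y: "?y i = y i" if "i \<in> S" for i
      using that insert.hyps by auto
    have "0 \<le> (\<Sum>i\<in>insert p S. \<Sum>j\<in>insert p S. a i j * ?y i * ?y j)"
      by (rule psd)
    also have "\<dots> = (\<Sum>i\<in>S. \<Sum>j\<in>S. a i j * ?y i * ?y j) + 2 * ?y p * (\<Sum>i\<in>S. a i p * ?y i)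
        + a p p * (?y p)\<^sup>2"
      using insert.hyps sym by (intro quadratic_form_insert) auto
    also have "\<dots> = (\<Sum>i\<in>S. \<Sum>j\<in>S. a i j * y i * y j) + 2 * t * (\<Sum>i\<in>S. a i p * y i) + a p p * t\<^sup>2"
      by (simp add: y del: fun_upd_apply) simp
    finally show ?thesis .
  qed
  have pp: "0 \<le> a p p"
    using form[of "\<lambda>_. 0" 1] by simp
  \<comment> \<open>If \<open>a p p = 0\<close>, the polynomial is affine in \<open>t\<close> and
    must have slope zero. For the unit vector at \<open>i\<close> and a nonzero
    \<open>a i p\<close>, the \<open>t\<close> chosen below would give the value -1.\<close>
  have zero: "a i p = 0" if "a p p = 0" "i \<in> S" for i
  proof (rule ccontr)
    assume nz: "a i p \<noteq> 0"
    let ?e = "\<lambda>j. if j = i then 1 else 0 :: real"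
    have "(\<Sum>k\<in>S. \<Sum>j\<in>S. a k j * ?e k * ?e j) =
        (\<Sum>k\<in>S. if k = i then \<Sum>j\<in>S. if j = i then a k j else 0 else 0)"
      by (auto intro!: sum.cong sum.neutral)
    also have "\<dots> = a i i"
      using that insert.hyps by simp
    finally have "(\<Sum>k\<in>S. \<Sum>j\<in>S. a k j * ?e k * ?e j) = a i i" .
    moreover have "(\<Sum>k\<in>S. a k p * ?e k) = a i p"
      using that insert.hyps by (simp add: if_distrib cong: if_cong)
    ultimately have "0 \<le> a i i + 2 * (- (a i i + 1) / (2 * a i p)) * a i p"
      using form[of ?e "- (a i i + 1) / (2 * a i p)"] that(1) by simp
    then show False
      using nz by (simp add: field_simps)
  qed
  \<comment> \<open>The Schur complement of the pivot \<open>a p p\<close>. For a zero pivot the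
    quotient is 0 by convention, so \<open>b\<close> is then just \<open>a\<close>.\<close>
  define b where "b i j = a i j - a i p * a j p / a p p" for i j
  have "\<exists>(m::nat) x. \<forall>i\<in>S. \<forall>j\<in>S. b i j = (\<Sum>s<m. x i s * x j s)"
  proof (rule insert.IH)
    show "b i j = b j i" if "i \<in> S" "j \<in> S" for i j
      using that sym by (simp add: b_def mult.commute)
    fix y
    let ?L = "\<Sum>i\<in>S. a i p * y i"
    have "?L\<^sup>2 = (\<Sum>i\<in>S. \<Sum>j\<in>S. a i p * a j p * y i * y j)"
      by (simp add: power2_eq_square sum_product mult_ac)
    then have "(\<Sum>i\<in>S. \<Sum>j\<in>S. b i j * y i * y j) =
        (\<Sum>i\<in>S. \<Sum>j\<in>S. a i j * y i * y j) - ?L\<^sup>2 / a p p"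
      by (simp add: b_def left_diff_distrib sum_subtractf sum_divide_distrib)
    moreover have "0 \<le> (\<Sum>i\<in>S. \<Sum>j\<in>S. a i j * y i * y j) - ?L\<^sup>2 / a p p"
      \<comment> \<open>For a positive pivot this \<open>t\<close> minimizes the polynomial, and the
        minimum is exactly the form of \<open>b\<close>. For a zero pivot it is
        \<open>t = 0\<close>.\<close>
      using form[of y "- ?L / a p p"]
      by (cases "a p p = 0") (simp_all add: power2_eq_square field_simps)
    ultimately show "0 \<le> (\<Sum>i\<in>S. \<Sum>j\<in>S. b i j * y i * y j)"
      by simp
  qed
  then obtain m :: nat and x where x: "\<And>i j. i \<in> S \<Longrightarrow> j \<in> S \<Longrightarrow> b i j = (\<Sum>s<m. x i s * x j s)"
    by blast
  \<comment> \<open>Coordinate \<open>m\<close> is the new Cholesky column; it restores the term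
    subtracted in \<open>b\<close>. The induction hypothesis says nothing about \<open>x p\<close>,
    so the old coordinates of \<open>p\<close> are set to 0.\<close>
  define z where "z i s = (if s < m then if i = p then 0 else x i s else a i p / sqrt (a p p))" for i s
  have "a i j = (\<Sum>s<Suc m. z i s * z j s)" if ij: "i \<in> insert p S" "j \<in> insert p S" for i j
  proof -
    have last: "z i m * z j m = a i p * a j p / a p p"
      using pp by (simp add: z_def)
    show ?thesis
    proof (cases "i = p \<or> j = p")
      case True
      then have "(\<Sum>s<m. z i s * z j s) = 0"
        by (intro sum.neutral) (auto simp: z_def)
      moreover have "a i j = a i p * a j p / a p p"
        using True ij sym zero by (cases "a p p = 0") auto
      ultimately show ?thesis
        using last by simp
    next
      case False
      then have "(\<Sum>s<m. z i s * z j s) = b i j"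
        using ij x by (auto simp: z_def intro!: sum.cong)
      then show ?thesis
        using last by (simp add: b_def)
    qed
  qed
  then show ?case by blast
qed

text \<open>In terms of Pauli matrices, the step is Z \<otimes> \<open>clifford m x\<close> +
  \<open>x m\<close> X \<otimes> I. The older generators get a factor Z and the new one is X
  \<otimes> I; as X and Z anticommute, so do all the generators.\<close>

fun clifford :: "nat \<Rightarrow> (nat \<Rightarrow> real) \<Rightarrow> complex Matrix.mat" where
  "clifford 0 x = 0\<^sub>m 1 1"
| "clifford (Suc m) x = four_block_mat
     (clifford m x) (complex_of_real (x m) \<cdot>\<^sub>m 1\<^sub>m (2 ^ m))
     (complex_of_real (x m) \<cdot>\<^sub>m 1\<^sub>m (2 ^ m)) (- clifford m x)"

lemma clifford_carrier [simp]: "clifford m x \<in> carrier_mat (2 ^ m) (2 ^ m)"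
proof (induction m)
  case (Suc m)
  have "(2::nat) ^ Suc m = 2 ^ m + 2 ^ m" by simp
  then show ?case
    using Suc by (auto intro!: four_block_carrier_mat)
qed simp

lemma clifford_dim [simp]:
  "dim_row (clifford m x) = 2 ^ m" "dim_col (clifford m x) = 2 ^ m"
  using carrier_matD[OF clifford_carrier] by blast+

lemma clifford_hermitian_entry:
  "i < 2 ^ m \<Longrightarrow> j < 2 ^ m \<Longrightarrow> cnj (clifford m x $$ (j, i)) = clifford m x $$ (i, j)"
  by (induction m arbitrary: i j) auto

lemma mat_adjoint_clifford: "mat_adjoint (clifford m x) = clifford m x"
  by (rule eq_matI)
    (auto simp: mat_adjoint_def mat_of_rows_index clifford_hermitian_entry)

text \<open>Serves two purposes: for \<open>x = y\<close> the off-diagonal blocks cancel, which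
  gives the square, and for general \<open>x\<close> and \<open>y\<close> the trace sees only the
  diagonal blocks.\<close>

lemma clifford_mult:
  "clifford (Suc m) x * clifford (Suc m) y = four_block_mat
     (clifford m x * clifford m y + complex_of_real (x m * y m) \<cdot>\<^sub>m 1\<^sub>m (2 ^ m))
     (complex_of_real (y m) \<cdot>\<^sub>m clifford m x - complex_of_real (x m) \<cdot>\<^sub>m clifford m y)
     (complex_of_real (x m) \<cdot>\<^sub>m clifford m y - complex_of_real (y m) \<cdot>\<^sub>m clifford m x)
     (complex_of_real (x m * y m) \<cdot>\<^sub>m 1\<^sub>m (2 ^ m) + clifford m x * clifford m y)"
proof -
  let ?n = "2 ^ m" and ?X = "clifford m x" and ?Y = "clifford m y"
  have X: "?X \<in> carrier_mat ?n ?n" and Y: "?Y \<in> carrier_mat ?n ?n" by simp_all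
  have one: "c \<cdot>\<^sub>m 1\<^sub>m ?n * A = c \<cdot>\<^sub>m A" "A * (c \<cdot>\<^sub>m 1\<^sub>m ?n) = c \<cdot>\<^sub>m A"
    if "A \<in> carrier_mat ?n ?n" for c and A :: "complex Matrix.mat"
    using that mult_smult_distrib[OF that one_carrier_mat] mult_smult_assoc_mat[OF one_carrier_mat that]
    by auto
  have neg: "- ?X * - ?Y = ?X * ?Y"
    using X Y by auto
  show ?thesis
    using X Y
    by (simp add: mult_four_block_mat[where ?n1.0 = ?n and ?n2.0 = ?n and ?nr1.0 = ?n
          and ?nr2.0 = ?n and ?nc1.0 = ?n and ?nc2.0 = ?n] one neg)
      (auto intro!: arg_cong4[where f = four_block_mat] eq_matI)
qed

lemma clifford_square:
  "clifford m x * clifford m x = complex_of_real (\<Sum>s<m. (x s)\<^sup>2) \<cdot>\<^sub>m 1\<^sub>m (2 ^ m)"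
proof (induction m)
  case 0
  show ?case by (rule eq_matI) auto
next
  case (Suc m)
  show ?case
    unfolding clifford_mult Suc
    by (rule eq_matI) (auto simp: power2_eq_square)
qed

lemma sum_mat_diag_four_block:
  fixes A D :: "complex Matrix.mat"
  assumes "A \<in> carrier_mat n n" "D \<in> carrier_mat n n"
  shows "(\<Sum>l<n + n. four_block_mat A B C D $$ (l, l)) = (\<Sum>l<n. A $$ (l, l)) + (\<Sum>l<n. D $$ (l, l))"
proof -
  have "(\<Sum>l<n + n. f l) = (\<Sum>l<n. f l) + (\<Sum>l<n. f (l + n))" for f :: "nat \<Rightarrow> complex"
    using sum.atLeastLessThan_concat[of 0 n "n + n" f] sum.shift_bounds_nat_ivl[of f 0 n n]
    by (simp add: lessThan_atLeast0)
  then show ?thesis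
    using assms by (auto intro!: arg_cong2[where f = "(+)"] sum.cong)
qed

text \<open>Both diagonal blocks of the product have the same trace: that of the previous level plus
  \<open>2 ^ m\<close> times \<open>x m * y m\<close>. Hence the dimension factor doubles while the
  inner product gains one term.\<close>

lemma trace_clifford_mult:
  "(\<Sum>l<2 ^ m. (clifford m x * clifford m y) $$ (l, l)) = 2 ^ m * complex_of_real (\<Sum>s<m. x s * y s)"
proof (induction m)
  case 0
  then show ?case by (simp add: scalar_prod_def)
next
  case (Suc m)
  let ?P = "clifford m x * clifford m y"
  let ?E = "complex_of_real (x m * y m) \<cdot>\<^sub>m 1\<^sub>m (2 ^ m) :: complex Matrix.mat"
  have car: "?P \<in> carrier_mat (2 ^ m) (2 ^ m)" "?E \<in> carrier_mat (2 ^ m) (2 ^ m)"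
    by (auto intro!: mult_carrier_mat[of _ _ "2 ^ m"])
  have two: "(2::nat) ^ Suc m = 2 ^ m + 2 ^ m" by simp
  have "(\<Sum>l<2 ^ m. (?P + ?E) $$ (l, l)) = (\<Sum>l<2 ^ m. ?P $$ (l, l) + complex_of_real (x m * y m))"
    "(\<Sum>l<2 ^ m. (?E + ?P) $$ (l, l)) = (\<Sum>l<2 ^ m. ?P $$ (l, l) + complex_of_real (x m * y m))"
    by (auto intro!: sum.cong)
  then show ?case
    unfolding clifford_mult two
    by (subst sum_mat_diag_four_block) (use car in \<open>auto simp: sum.distrib Suc algebra_simps simp del: index_mult_mat(1)\<close>)
qed

lemma normalized_trace_clifford:
  "normalized_trace (2 ^ m) (mat_adjoint (clifford m x) * clifford m y) =
     complex_of_real (\<Sum>s<m. x s * y s)"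
  by (simp add: normalized_trace_def mat_adjoint_clifford trace_clifford_mult del: of_real_sum index_mult_mat(1))

text \<open>The matrix is self-adjoint and, for a unit vector, squares to the identity, so it is
  inverse to its own adjoint.\<close>

lemma clifford_unitary:
  assumes "(\<Sum>s<m. (x s)\<^sup>2) = 1"
  shows "clifford m x \<in> unitary_group (2 ^ m)"
  using assms clifford_square[of m x]
  by (auto simp: unitary_group_def mat_adjoint_clifford smult_one simp del: of_real_sum)

text \<open>The Gram vectors must be real, since real coefficients are what keeps the Clifford
  matrices self-adjoint.\<close>

lemma real_psd_matrix_gram:
  fixes A :: "complex ^ 'n ^ 'n"
  assumes "A \<in> real_matrices" "psd_matrix A"
  shows "\<exists>(m::nat) x. \<forall>i j. A $ i $ j = complex_of_real (\<Sum>s<m. x i s * x j s)"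
proof -
  define a where "a i j = Re (A $ i $ j)" for i j
  have A: "A $ i $ j = complex_of_real (a i j)" for i j
    using assms(1) by (auto simp: real_matrices_def a_def)
  have "\<exists>(m::nat) x. \<forall>i\<in>UNIV. \<forall>j\<in>UNIV. a i j = (\<Sum>s<m. x i s * x j s)"
  proof (rule psd_form_gram)
    show "a i j = a j i" for i j
      using assms(2) unfolding psd_matrix_def hermitian_matrix_def
      by (metis A a_def complex_cnj_complex_of_real)
    fix y :: "'n \<Rightarrow> real"
    \<comment> \<open>Test vectors with real entries suffice to make the real form
      nonnegative.\<close>
    let ?y = "\<chi> i. complex_of_real (y i)"
    have "0 \<le> (\<Sum>i\<in>UNIV. cnj (?y $ i) * (A *v ?y) $ i)"
      using assms(2) unfolding psd_matrix_def by blast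
    also have "\<dots> = complex_of_real (\<Sum>i\<in>UNIV. \<Sum>j\<in>UNIV. a i j * y i * y j)"
      by (simp add: matrix_vector_mult_def A sum_distrib_left mult_ac)
    finally show "0 \<le> (\<Sum>i\<in>UNIV. \<Sum>j\<in>UNIV. a i j * y i * y j)"
      by (simp add: less_eq_complex_def del: of_real_sum)
  qed simp
  then show ?thesis
    unfolding A by (metis UNIV_I)
qed

theorem theorem3p1:
  shows "real_matrices \<inter> correlation_matrices
           \<subseteq> (unitary_correlation_matrices :: (complex ^ 'n ^ 'n) set)"
proof
  fix A :: "complex ^ 'n ^ 'n"
  assume A: "A \<in> real_matrices \<inter> correlation_matrices"
  then obtain m :: nat and x where x: "\<And>i j. A $ i $ j = complex_of_real (\<Sum>s<m. x i s * x j s)"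
    using real_psd_matrix_gram[of A] by (auto simp: correlation_matrices_def)
  \<comment> \<open>The unit diagonal of \<open>A\<close> makes every Gram vector a unit
    vector.\<close>
  have "complex_of_real (\<Sum>s<m. (x i s)\<^sup>2) = 1" for i
    using A x[of i i] by (simp add: correlation_matrices_def power2_eq_square)
  then have "clifford m (x i) \<in> unitary_group (2 ^ m)" for i
    by (intro clifford_unitary) (simp only: of_real_eq_1_iff)
  moreover have "A = (\<chi> i j. normalized_trace (2 ^ m)
      (mat_adjoint (clifford m (x i)) * clifford m (x j)))"
    by (simp add: Finite_Cartesian_Product.vec_eq_iff normalized_trace_clifford x)
  ultimately show "A \<in> unitary_correlation_matrices"
    unfolding unitary_correlation_matrices_def
    by (intro subsetD[OF closure_subset] CollectI exI[of _ "2 ^ m"] exI[of _ "\<lambda>i. clifford m (x i)"]) simp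
qed

end
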